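(* Let $n$ and $m$ be positive integers, not both equal to $1$. Let $\tilde{f}:\mathbb{F}_2^n\to\mathbb{F}_2^n$ and $\tilde{g}:\mathbb{F}_2^m\to\mathbb{F}_2^m$ be transition functions of an $n$-stage FSR (with characteristic function $f$) and an $m$-stage FSR (with characteristic function $g$), respectively, and assume that $\tilde{f}$ and $\tilde{g}$ are permutations, i.e. $\tilde{f}\in\mathrm{Sym}(\mathbb{F}_2^n)$ and $\tilde{g}\in\mathrm{Sym}(\mathbb{F}_2^m)$. Then the maximum (over all initial states in $\mathbb{F}_2^{m+n}$) of the least period of an output sequence of the cascaded connection $\mathrm{FSR}(f;g)$ is at most $$\max\{2^n(2^m-1),\,2^m(2^n-1)\}=2^{\min\{m,n\}}\left(2^{\max\{m,n\}}-1\right).$$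
   Context: An $n$-stage feedback shift register (FSR) with characteristic function $f(x_0,\ldots,x_n)=f_1(x_0,\ldots,x_{n-1})+x_n$ (over $\mathbb{F}_2$), where the update function $f_1:\mathbb{F}_2^n\to\mathbb{F}_2$ is an arbitrary Boolean function, is denoted $\mathrm{FSR}(f)$. Its transition function is $\tilde{f}:\mathbb{F}_2^n\to\mathbb{F}_2^n$, $(x_0,\ldots,x_{n-1})\mapsto(x_1,\ldots,x_{n-1},f_1(x_0,\ldots,x_{n-1}))$. The same notation is used for $g$, with update function $g_1:\mathbb{F}_2^m\to\mathbb{F}_2$. The cascaded connection $\mathrm{FSR}(f;g)$ of $\mathrm{FSR}(f)$ into $\mathrm{FSR}(g)$ has transition function $\tilde{f}\ast\tilde{g}:\mathbb{F}_2^{m+n}\to\mathbb{F}_2^{m+n}$, $$(x_0,\ldots,x_{m-1},y_0,\ldots,y_{n-1})\mapsto(x_1,\ldots,x_{m-1},\,g_1(x_0,\ldots,x_{m-1})+y_0,\,y_1,\ldots,y_{n-1},\,f_1(y_0,\ldots,y_{n-1})).$$ When initialized with $\vec{v}\in\mathbb{F}_2^{m+n}$, its output sequence is $(b_t)_{t\ge 0}$, where $b_t$ is the first coordinate of $(\tilde{f}\ast\tilde{g})^t(\vec{v})$. *)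

theory Defs
  imports Main "HOL-Library.Z2"
begin

text \<open>Vectors over the two-element field (type \<^typ>\<open>bit\<close>) are lists, first coordinate at the head.\<close>

definition F2vec :: "nat \<Rightarrow> bit list set" where
  "F2vec n = {v. length v = n}"

text \<open>
  An n-stage FSR is given by its update function \<open>f1\<close>; its characteristic function is
  \<open>f (x\<^sub>0, \<dots>, x\<^sub>n) = f1 (x\<^sub>0, \<dots>, x\<^sub>n\<^sub>-\<^sub>1) + x\<^sub>n\<close>. Only the values of \<open>f1\<close> on lists
  of length n matter.
\<close>

definition fsr_trans :: "(bit list \<Rightarrow> bit) \<Rightarrow> bit list \<Rightarrow> bit list" where
  "fsr_trans f1 x = tl x @ [f1 x]"

text \<open>
  A state of the cascade is \<open>x @ y\<close>, where \<open>x\<close> is the m-stage register with update function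
  \<open>g1\<close>, and \<open>y\<close> is the register with update function \<open>f1\<close>, whose output \<open>y\<^sub>0\<close> is fed into
  the former.
\<close>

definition cascade_trans ::
    "nat \<Rightarrow> (bit list \<Rightarrow> bit) \<Rightarrow> (bit list \<Rightarrow> bit) \<Rightarrow> bit list \<Rightarrow> bit list" where
  "cascade_trans m f1 g1 v =
     (let x = take m v; y = drop m v
      in tl x @ [g1 x + hd y] @ tl y @ [f1 y])"

definition cascade_output ::
    "nat \<Rightarrow> (bit list \<Rightarrow> bit) \<Rightarrow> (bit list \<Rightarrow> bit) \<Rightarrow> bit list \<Rightarrow> nat \<Rightarrow> bit" where
  "cascade_output m f1 g1 v t = hd ((cascade_trans m f1 g1 ^^ t) v)"

text \<open>
  Meaningful for purely periodic sequences. The outputs of a cascade whose two components have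
  bijective transition functions are purely periodic.
\<close>

definition least_period :: "(nat \<Rightarrow> 'a) \<Rightarrow> nat" where
  "least_period b = (LEAST p. 0 < p \<and> (\<forall>t. b (t + p) = b t))"

end

theory Submission
  imports Defs "HOL-Combinatorics.Cycles"
begin

text \<open>
  The cascade is a skew product: the driving register \<open>y\<close> moves on its own by the permutation
  \<open>fsr_trans f1\<close>, and \<open>x\<close> moves by a permutation that depends on \<open>y\<close>, namely \<open>fsr_trans g1\<close>
  followed by adding \<open>y\<^sub>0\<close> to the last coordinate. If \<open>y\<close> has period \<open>k\<close>, then one turn of its cycle
  acts on \<open>x\<close> by a permutation \<open>P\<close> of \<open>F\<^sub>2\<^sup>m\<close>, and if \<open>x\<close> has period \<open>l\<close> under \<open>P\<close>, the
  state \<open>(x, y)\<close> returns after \<open>k l\<close> steps, where \<open>k \<le> 2\<^sup>n\<close> and \<open>l \<le> 2\<^sup>m\<close>. If one of these two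
  inequalities is strict, \<open>k l\<close> obeys the bound. So the claim is that both cannot be equalities.

  If both are, parity gives a contradiction. On the one hand \<open>P\<close> is a single cycle of even length
  \<open>2\<^sup>m\<close>, hence odd (\<open>sign_if_least_power_eq_card\<close>). On the other hand the cycle of \<open>y\<close> visits all of
  \<open>F\<^sub>2\<^sup>n\<close>, so \<open>P\<close> is a product of \<open>2\<^sup>n\<close> copies of \<open>fsr_trans g1\<close>, which contribute sign 1, and of
  \<open>2\<^sup>n\<^sup>-\<^sup>1\<close> copies of the flip of the last coordinate. The flip is even if \<open>m \<ge> 2\<close>
  (\<open>sign_add_to_last\<close>), and the number of copies is even if \<open>n \<ge> 2\<close>. Hence \<open>P\<close> is even
  (\<open>prod_sign_driven_step\<close>). The case \<open>m = n = 1\<close>, where a single odd flip remains, is the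
  one that the argument must exclude.
\<close>

section \<open>Permutations with a cycle through all points\<close>

lemma sign_cycle_of_list:
  assumes "distinct cs" "cs \<noteq> []"
  shows "sign (cycle_of_list cs) = (-1) ^ (length cs - 1)"
  using assms
proof (induction cs rule: cycle_of_list.induct)
  case (1 i j cs)
  have "sign (cycle_of_list (i # j # cs)) = sign (transpose i j) * sign (cycle_of_list (j # cs))"
    unfolding cycle_of_list.simps by (intro sign_compose permutation_swap_id permutation_of_cycle)
  moreover have "sign (cycle_of_list (j # cs)) = (-1) ^ length cs"
    using 1 by simp
  moreover have "sign (transpose i j) = -1"
    using 1 by (simp add: sign_swap_id)
  ultimately show ?case by (simp del: cycle_of_list.simps)
qed simp_all

lemma set_support_subset:
  assumes "p permutes S" "a \<in> S"
  shows "set (support p a) \<subseteq> S"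
  using assms permutes_in_image[OF permutes_funpow[OF assms(1)]] by auto

lemma least_power_le_card:
  assumes "finite S" "p permutes S" "a \<in> S"
  shows "least_power p a \<le> card S"
proof -
  have "distinct (support p a)"
    using assms by (intro cycle_of_permutation permutes_imp_permutation)
  then have "card (set (support p a)) = least_power p a"
    using distinct_card[of "support p a"] by simp
  then show ?thesis using card_mono[OF assms(1) set_support_subset[OF assms(2,3)]] by simp
qed

lemma set_support_eq_if_least_power_eq_card:
  assumes "finite S" "p permutes S" "a \<in> S" "least_power p a = card S"
  shows "set (support p a) = S"
proof -
  have "distinct (support p a)"
    using assms by (intro cycle_of_permutation permutes_imp_permutation)
  then have "card (set (support p a)) = card S"
    using distinct_card[of "support p a"] assms(4) by simp
  then show ?thesis
    using card_subset_eq[OF assms(1) set_support_subset[OF assms(2,3)]] by simp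
qed

text \<open>A point whose period is the size of the whole set has an orbit that fills the set, so the
  permutation equals the cycle through that point.\<close>

lemma sign_if_least_power_eq_card:
  assumes "finite S" "p permutes S" "a \<in> S" "least_power p a = card S"
  shows "sign p = (-1) ^ (card S - 1)"
proof -
  have perm: "permutation p" using assms permutes_imp_permutation by blast
  have S: "set (support p a) = S"
    by (rule set_support_eq_if_least_power_eq_card[OF assms])
  have "p x = cycle_of_list (support p a) x" for x
  proof (cases "x \<in> S")
    case True
    then show ?thesis using cycle_restrict[OF perm, of x a] S by simp
  next
    case False
    then show ?thesis
      using id_outside_supp[of x "support p a"] permutes_not_in[OF assms(2)] S by simp
  qed
  then have "p = cycle_of_list (support p a)" by blast
  moreover have "distinct (support p a)" by (rule cycle_of_permutation[OF perm])
  moreover have "support p a \<noteq> []" using assms(3) S by auto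
  ultimately have "sign p = (-1) ^ (length (support p a) - 1)"
    using sign_cycle_of_list by metis
  then show ?thesis using assms(4) by simp
qed

section \<open>Skew products of permutations\<close>

text \<open>The map by which \<open>j\<close> steps of the skew product act on the first component while the second
  component runs from \<open>y\<close> to \<open>(f ^^ j) y\<close>; if \<open>j\<close> is a period of \<open>y\<close>, it is the return map of the
  fibre over \<open>y\<close>.\<close>

primrec fibre_map :: "('b \<Rightarrow> 'a \<Rightarrow> 'a) \<Rightarrow> ('b \<Rightarrow> 'b) \<Rightarrow> 'b \<Rightarrow> nat \<Rightarrow> 'a \<Rightarrow> 'a" where
  "fibre_map h f y 0 = id"
| "fibre_map h f y (Suc j) = h ((f ^^ j) y) \<circ> fibre_map h f y j"

abbreviation skew_product :: "('b \<Rightarrow> 'a \<Rightarrow> 'a) \<Rightarrow> ('b \<Rightarrow> 'b) \<Rightarrow> 'a \<times> 'b \<Rightarrow> 'a \<times> 'b" where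
  "skew_product h f \<equiv> \<lambda>(x, y). (h y x, f y)"

lemma skew_product_funpow:
  "(skew_product h f ^^ j) (x, y) = (fibre_map h f y j x, (f ^^ j) y)"
  by (induction j) auto

lemma fibre_map_permutes:
  assumes "f permutes Y" "\<And>y. y \<in> Y \<Longrightarrow> h y permutes X" "y \<in> Y"
  shows "fibre_map h f y j permutes X"
proof (induction j)
  case 0
  show ?case unfolding fibre_map.simps by (rule permutes_id)
next
  case (Suc j)
  have "(f ^^ j) y \<in> Y" using permutes_in_image[OF permutes_funpow[OF assms(1)]] assms(3) by blast
  then show ?case unfolding fibre_map.simps by (intro permutes_compose[OF Suc] assms(2))
qed

lemma sign_fibre_map:
  assumes "finite X" "f permutes Y" "\<And>y. y \<in> Y \<Longrightarrow> h y permutes X" "y \<in> Y"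
  shows "sign (fibre_map h f y j) = (\<Prod>i<j. sign (h ((f ^^ i) y)))"
proof (induction j)
  case (Suc j)
  have "(f ^^ j) y \<in> Y" using permutes_in_image[OF permutes_funpow[OF assms(2)]] assms(4) by blast
  then have "permutation (h ((f ^^ j) y))"
    by (intro permutes_imp_permutation[OF assms(1)] assms(3))
  moreover have "permutation (fibre_map h f y j)"
    by (rule permutes_imp_permutation[OF assms(1) fibre_map_permutes[OF assms(2,3,4)]])
  ultimately have "sign (fibre_map h f y (Suc j)) = sign (h ((f ^^ j) y)) * sign (fibre_map h f y j)"
    unfolding fibre_map.simps by (rule sign_compose)
  then show ?case unfolding Suc by (simp add: mult.commute del: fibre_map.simps)
qed simp

text \<open>Turns the product along an orbit of the base, which is the form of \<open>sign_fibre_map\<close>, into a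
  product that no longer depends on the dynamics of \<open>f\<close>.\<close>

lemma prod_over_full_cycle:
  assumes "finite Y" "f permutes Y" "y \<in> Y" "least_power f y = card Y"
  shows "(\<Prod>i<card Y. c ((f ^^ i) y)) = (\<Prod>z\<in>Y. c z)"
proof -
  have "distinct (support f y)"
    using assms by (intro cycle_of_permutation permutes_imp_permutation)
  then have inj: "inj_on (\<lambda>i. (f ^^ i) y) {..<card Y}"
    using assms(4) by (simp add: distinct_map lessThan_atLeast0)
  have "(\<lambda>i. (f ^^ i) y) ` {..<card Y} = Y"
    using set_support_eq_if_least_power_eq_card[OF assms] assms(4) by (simp add: lessThan_atLeast0)
  then show ?thesis using prod.reindex[OF inj, of c] by simp
qed

text \<open>The return time found is the product of the period \<open>k\<close> of \<open>y\<close> and the period \<open>l\<close> of \<open>x\<close> under the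
  return map. If \<open>k\<close> and \<open>l\<close> were both maximal, the return map would be a cycle of even length, hence
  odd, while its sign is the product of all \<open>sign (h y)\<close>.\<close>

lemma skew_product_returns_early:
  assumes fin: "finite X" "finite Y"
    and f: "f permutes Y" and h: "\<And>y. y \<in> Y \<Longrightarrow> h y permutes X"
    and even: "even (card X)" and sign: "(\<Prod>y\<in>Y. sign (h y)) = 1"
    and x: "x \<in> X" and y: "y \<in> Y"
  obtains p where "0 < p" "p \<le> max (card Y * (card X - 1)) (card X * (card Y - 1))"
    "(skew_product h f ^^ p) (x, y) = (x, y)"
proof -
  define k where "k = least_power f y"
  define P where "P = fibre_map h f y k"
  define l where "l = least_power P x"
  have Pperm: "P permutes X" unfolding P_def by (rule fibre_map_permutes[OF f h y])
  have k: "(f ^^ k) y = y" "0 < k" "k \<le> card Y"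
    unfolding k_def using least_power_of_permutation[OF permutes_imp_permutation[OF fin(2) f]]
      least_power_le_card[OF fin(2) f y] by auto
  have l: "(P ^^ l) x = x" "0 < l" "l \<le> card X"
    unfolding l_def using least_power_of_permutation[OF permutes_imp_permutation[OF fin(1) Pperm]]
      least_power_le_card[OF fin(1) Pperm x] by auto
  have iter: "((skew_product h f ^^ k) ^^ i) (z, y) = ((P ^^ i) z, y)" for i z
    by (induction i) (auto simp: skew_product_funpow k(1) P_def)
  have ret: "(skew_product h f ^^ (k * l)) (x, y) = (x, y)"
    using iter[of l x] l(1) funpow_mult[of l k "skew_product h f"] by (simp only: mult.commute[of l k])
  have "k < card Y \<or> l < card X"
  proof (rule ccontr)
    assume "\<not> (k < card Y \<or> l < card X)"
    then have full: "k = card Y" "l = card X" using k l by auto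
    have "sign P = (\<Prod>i<card Y. sign (h ((f ^^ i) y)))"
      unfolding P_def full(1) by (rule sign_fibre_map[OF fin(1) f h y])
    also have "\<dots> = 1"
      using prod_over_full_cycle[OF fin(2) f y, of "\<lambda>y. sign (h y)"] full(1) sign
      by (simp add: k_def)
    finally have "sign P = 1" .
    moreover have "sign P = (-1) ^ (card X - 1)"
      using sign_if_least_power_eq_card[OF fin(1) Pperm x] full(2) by (simp add: l_def)
    moreover have "odd (card X - 1)"
      using even x fin(1) by (auto simp: card_gt_0_iff)
    ultimately show False by simp
  qed
  then have "k * l \<le> max (card Y * (card X - 1)) (card X * (card Y - 1))"
  proof
    assume "k < card Y"
    then have "l * k \<le> card X * (card Y - 1)" using l(3) by (intro mult_le_mono) auto
    then show ?thesis by (simp add: mult.commute le_max_iff_disj)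
  next
    assume "l < card X"
    then have "k * l \<le> card Y * (card X - 1)" using k(3) by (intro mult_le_mono) auto
    then show ?thesis by (simp add: le_max_iff_disj)
  qed
  with ret k(2) l(2) show thesis by (intro that[of "k * l"]) auto
qed

section \<open>The parity of the driven register\<close>

lemma finite_F2vec: "finite (F2vec n)" and card_F2vec: "card (F2vec n) = 2 ^ n"
proof -
  have bits: "(UNIV :: bit set) = {0, 1}" by (auto intro: bit_not_one_iff[THEN iffD1])
  have fin: "finite (UNIV :: bit set)" unfolding bits by simp
  have eq: "F2vec n = {xs. set xs \<subseteq> UNIV \<and> length xs = n}" by (simp add: F2vec_def)
  show "finite (F2vec n)" unfolding eq by (rule finite_lists_length_eq[OF fin])
  have "card (UNIV :: bit set) = 2" unfolding bits by simp
  then show "card (F2vec n) = 2 ^ n" unfolding eq card_lists_length_eq[OF fin] by simp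
qed

lemma card_F2vec_hd_1:
  assumes "0 < n"
  shows "card {y \<in> F2vec n. hd y = 1} = 2 ^ (n - 1)"
proof -
  have "{y \<in> F2vec n. hd y = 1} = (#) 1 ` F2vec (n - 1)"
  proof (intro set_eqI iffI)
    fix y assume "y \<in> {y \<in> F2vec n. hd y = 1}"
    then show "y \<in> (#) 1 ` F2vec (n - 1)"
      using assms by (cases y) (auto simp: F2vec_def)
  qed (use assms in \<open>auto simp: F2vec_def\<close>)
  then show ?thesis by (simp add: card_image card_F2vec)
qed

definition add_to_last :: "bit \<Rightarrow> bit list \<Rightarrow> bit list" where
  "add_to_last b x = butlast x @ [last x + b]"

lemma length_add_to_last [simp]: "x \<noteq> [] \<Longrightarrow> length (add_to_last b x) = length x"
  by (simp add: add_to_last_def)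

lemma bit_add_cancel [simp]: "a + b + b = (a :: bit)"
  by (cases "a = 0"; cases "b = 0") auto

lemma add_to_last_involution: "x \<noteq> [] \<Longrightarrow> add_to_last b (add_to_last b x) = x"
  by (simp add: add_to_last_def del: add_bit_eq_xor)

lemma bij_betw_add_to_last:
  assumes "0 < m"
  shows "bij_betw (add_to_last b) (F2vec m) (F2vec m)"
  by (rule bij_betw_byWitness[where f' = "add_to_last b"])
     (use assms in \<open>auto simp: F2vec_def add_to_last_involution\<close>)

text \<open>On the first and last coordinates this is the 4-cycle
  \<open>00 \<mapsto> 10 \<mapsto> 01 \<mapsto> 11 \<mapsto> 00\<close>, chosen as a square root of the flip of the last
  coordinate.\<close>

definition shear :: "bit list \<Rightarrow> bit list" where
  "shear x = (hd x + 1) # butlast (tl x) @ [last x + hd x]"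

lemma shear_shear:
  assumes "2 \<le> length x"
  shows "shear (shear x) = add_to_last 1 x"
proof -
  obtain a u where x: "x = a # u" and u: "u \<noteq> []"
    using assms by (metis Suc_le_length_iff numeral_2_eq_2 list.distinct(1))
  have "last u + a + (a + 1) = last u + 1"
    by (simp only: add.assoc[symmetric] bit_add_cancel)
  then show ?thesis
    using u by (simp add: x shear_def add_to_last_def del: add_bit_eq_xor)
qed

lemma bij_betw_shear:
  assumes "2 \<le> m"
  shows "bij_betw shear (F2vec m) (F2vec m)"
proof -
  have len: "length (shear x) = m" if "length x = m" for x
    using assms that by (simp add: shear_def)
  have inj: "inj_on shear (F2vec m)"
  proof (rule inj_onI)
    fix x x' assume x: "x \<in> F2vec m" "x' \<in> F2vec m" and "shear x = shear x'"
    then have "add_to_last 1 x = add_to_last 1 x'"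
      using assms shear_shear unfolding F2vec_def by (metis mem_Collect_eq)
    then show "x = x'"
      using bij_betw_imp_inj_on[OF bij_betw_add_to_last[of m 1]] x assms by (auto dest: inj_onD)
  qed
  moreover have "shear ` F2vec m = F2vec m"
    using len by (intro endo_inj_surj[OF finite_F2vec _ inj]) (auto simp: F2vec_def)
  ultimately show ?thesis by (simp add: bij_betw_def)
qed

text \<open>A square of a permutation is even. The square root needs a first coordinate other than the last
  one; for \<open>m = 1\<close> the flip is a transposition.\<close>

lemma sign_add_to_last:
  assumes "2 \<le> m"
  shows "sign_on (F2vec m) (add_to_last 1) = 1"
proof -
  have "sign_on (F2vec m) (add_to_last 1) = sign_on (F2vec m) (shear \<circ> shear)"
    using assms by (intro sign_on_cong) (auto simp: F2vec_def shear_shear)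
  also have "\<dots> = sign_on (F2vec m) shear * sign_on (F2vec m) shear"
    using bij_betw_shear[OF assms] by (intro sign_on_compose finite_F2vec)
  also have "\<dots> = 1" by (simp add: sign_on_def)
  finally show ?thesis .
qed

definition driven_step :: "(bit list \<Rightarrow> bit) \<Rightarrow> bit list \<Rightarrow> bit list \<Rightarrow> bit list" where
  "driven_step g1 y = add_to_last (hd y) \<circ> fsr_trans g1"

lemma bij_betw_driven_step:
  assumes "0 < m" "bij_betw (fsr_trans g1) (F2vec m) (F2vec m)"
  shows "bij_betw (driven_step g1 y) (F2vec m) (F2vec m)"
  unfolding driven_step_def by (rule bij_betw_trans[OF assms(2) bij_betw_add_to_last[OF assms(1)]])

text \<open>The shift by \<open>g1\<close> occurs \<open>2\<^sup>n\<close> times and the flip once for each of the \<open>2\<^sup>n\<^sup>-\<^sup>1\<close> vectors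
  with first coordinate 1. The first number is always even; the second is odd only for \<open>n = 1\<close>, and
  then \<open>m \<ge> 2\<close>, which makes the flip itself even.\<close>

lemma prod_sign_driven_step:
  assumes "0 < n" "0 < m" "\<not> (n = 1 \<and> m = 1)"
    and g: "bij_betw (fsr_trans g1) (F2vec m) (F2vec m)"
  shows "(\<Prod>y\<in>F2vec n. sign_on (F2vec m) (driven_step g1 y)) = 1"
proof -
  define sg where "sg = sign_on (F2vec m) (fsr_trans g1)"
  define sa where "sa = sign_on (F2vec m) (add_to_last 1)"
  have "sign_on (F2vec m) (driven_step g1 y) = (if hd y = 1 then sa else 1) * sg" for y
  proof -
    have "sign_on (F2vec m) (driven_step g1 y) = sign_on (F2vec m) (add_to_last (hd y)) * sg"
      unfolding driven_step_def sg_def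
      using assms by (intro sign_on_compose bij_betw_add_to_last finite_F2vec)
    moreover have "sign_on (F2vec m) (add_to_last 0) = sign_on (F2vec m) id"
      using assms(2) by (intro sign_on_cong) (auto simp: F2vec_def add_to_last_def simp del: add_bit_eq_xor)
    ultimately show ?thesis by (cases "hd y = 1") (auto simp: sa_def)
  qed
  then have "(\<Prod>y\<in>F2vec n. sign_on (F2vec m) (driven_step g1 y)) =
      (\<Prod>y\<in>F2vec n. if hd y = 1 then sa else 1) * sg ^ 2 ^ n"
    by (simp add: prod.distrib card_F2vec)
  also have "(\<Prod>y\<in>F2vec n. if hd y = 1 then sa else 1) = sa ^ 2 ^ (n - 1)"
  proof -
    have "F2vec n \<inter> {y. hd y = 1} = {y \<in> F2vec n. hd y = 1}" by blast
    then have "card (F2vec n \<inter> {y. hd y = 1}) = 2 ^ (n - 1)"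
      using card_F2vec_hd_1[OF assms(1)] by (simp only:)
    then show ?thesis by (simp add: prod.If_cases finite_F2vec)
  qed
  also have "sa ^ 2 ^ (n - 1) = 1"
  proof (cases "2 \<le> m")
    case True
    then show ?thesis by (simp add: sa_def sign_add_to_last)
  next
    case False
    then have "even ((2::nat) ^ (n - 1))" using assms by auto
    moreover have "\<bar>sa\<bar> = 1" by (simp add: sa_def sign_on_def)
    ultimately show ?thesis by (metis power_even_abs power_one)
  qed
  also have "sg ^ 2 ^ n = 1"
  proof -
    have "even ((2::nat) ^ n)" using assms(1) by simp
    moreover have "\<bar>sg\<bar> = 1" by (simp add: sg_def sign_on_def)
    ultimately show ?thesis by (metis power_even_abs power_one)
  qed
  finally show ?thesis by simp
qed

section \<open>The cascade as a skew product\<close>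

lemma cascade_trans_append:
  assumes "x \<in> F2vec m" "y \<noteq> []"
  shows "cascade_trans m f1 g1 (x @ y) = driven_step g1 y x @ fsr_trans f1 y"
  using assms
  by (simp add: cascade_trans_def F2vec_def driven_step_def fsr_trans_def add_to_last_def
      del: add_bit_eq_xor)

text \<open>The transition maps act on lists of every length; restricting them to the state spaces makes
  them permutations of the whole type, to which the results on skew products apply.\<close>

lemma cascade_trans_funpow:
  fixes f1 g1 :: "bit list \<Rightarrow> bit"
  assumes "0 < n" "x \<in> F2vec m" "y \<in> F2vec n"
    and f: "bij_betw (fsr_trans f1) (F2vec n) (F2vec n)"
    and h: "\<And>y. bij_betw (driven_step g1 y) (F2vec m) (F2vec m)"
  defines "F \<equiv> skew_product (\<lambda>y. restrict_id (driven_step g1 y) (F2vec m))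
                             (restrict_id (fsr_trans f1) (F2vec n))"
  shows "(cascade_trans m f1 g1 ^^ t) (x @ y) = fst ((F ^^ t) (x, y)) @ snd ((F ^^ t) (x, y))"
proof -
  have "(F ^^ t) (x, y) \<in> F2vec m \<times> F2vec n \<and>
      (cascade_trans m f1 g1 ^^ t) (x @ y) = fst ((F ^^ t) (x, y)) @ snd ((F ^^ t) (x, y))"
  proof (induction t)
    case 0
    then show ?case using assms by simp
  next
    case (Suc t)
    obtain x' y' where xy: "(F ^^ t) (x, y) = (x', y')" by force
    with Suc have mem: "x' \<in> F2vec m" "y' \<in> F2vec n" by auto
    then have "y' \<noteq> []" using assms(1) by (auto simp: F2vec_def)
    moreover have "driven_step g1 y' x' \<in> F2vec m" "fsr_trans f1 y' \<in> F2vec n"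
      using mem bij_betwE[OF h] bij_betwE[OF f] by auto
    ultimately show ?case using Suc mem xy by (simp add: F_def cascade_trans_append)
  qed
  then show ?thesis by blast
qed

lemma least_period_orbit_le:
  assumes "0 < p" "(F ^^ p) v = v"
  shows "least_period (\<lambda>t. c ((F ^^ t) v)) \<le> p"
  unfolding least_period_def using assms by (intro Least_le) (simp add: funpow_add)

lemma max_pow2_products:
  "max (2 ^ n * (2 ^ m - 1)) (2 ^ m * (2 ^ n - 1)) = (2 ^ min m n * (2 ^ max m n - 1) :: nat)"
proof -
  have pow_min: "(2::nat) ^ min m n = min (2 ^ m) (2 ^ n)"
    by (simp add: min_def)
  have pow_sum: "(2::nat) ^ min m n * 2 ^ max m n = 2 ^ m * 2 ^ n"
    by (simp add: min_def max_def)
  have "(2 ^ min m n * (2 ^ max m n - 1) :: nat) = 2 ^ m * 2 ^ n - min (2 ^ m) (2 ^ n)"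
    by (simp only: diff_mult_distrib2 pow_sum mult_1_right) (simp only: pow_min)
  moreover have "max (c - a) (c - b) = c - min b a" for a b c :: nat
    by linarith
  ultimately show ?thesis
    by (simp only: diff_mult_distrib2 mult.commute[of "2 ^ n" "2 ^ m"] mult_1_right)
qed

section \<open>The bound on the least period\<close>

theorem theorem4p1:
  fixes n m :: nat and f1 g1 :: "bit list \<Rightarrow> bit"
  assumes "0 < n" and "0 < m" and "\<not> (n = 1 \<and> m = 1)"
    and "bij_betw (fsr_trans f1) (F2vec n) (F2vec n)"
    and "bij_betw (fsr_trans g1) (F2vec m) (F2vec m)"
  shows "Max ((\<lambda>v. least_period (cascade_output m f1 g1 v)) ` F2vec (m + n))
           \<le> max (2 ^ n * (2 ^ m - 1)) (2 ^ m * (2 ^ n - 1))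
       \<and> max (2 ^ n * (2 ^ m - 1)) (2 ^ m * (2 ^ n - 1))
           = (2 ^ min m n * (2 ^ max m n - 1) :: nat)"
proof
  let ?B = "max (2 ^ n * (2 ^ m - 1)) (2 ^ m * (2 ^ n - 1)) :: nat"
  let ?h = "\<lambda>y. restrict_id (driven_step g1 y) (F2vec m)"
  let ?f = "restrict_id (fsr_trans f1) (F2vec n)"
  have h: "bij_betw (driven_step g1 y) (F2vec m) (F2vec m)" for y
    using assms by (intro bij_betw_driven_step)
  have bound: "least_period (cascade_output m f1 g1 v) \<le> ?B" if "v \<in> F2vec (m + n)" for v
  proof -
    define x y where "x = take m v" and "y = drop m v"
    have xy: "x \<in> F2vec m" "y \<in> F2vec n" and v: "v = x @ y"
      using that by (auto simp: x_def y_def F2vec_def)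
    have "even (card (F2vec m))" using assms by (simp add: card_F2vec)
    moreover have "(\<Prod>y\<in>F2vec n. sign (?h y)) = 1"
      using prod_sign_driven_step[OF assms(1-3,5)] by (simp add: sign_on_def)
    ultimately obtain p where p: "0 < p" "p \<le> ?B" "(skew_product ?h ?f ^^ p) (x, y) = (x, y)"
      using skew_product_returns_early[OF finite_F2vec finite_F2vec, of ?f n ?h m x y]
        permutes_restrict_id[OF assms(4)] permutes_restrict_id[OF h] xy
      by (auto simp: card_F2vec)
    then have "(cascade_trans m f1 g1 ^^ p) v = v"
      using cascade_trans_funpow[OF assms(1) xy assms(4) h] v by simp
    then have "least_period (cascade_output m f1 g1 v) \<le> p"
      using least_period_orbit_le[OF p(1), of _ v hd] by (simp add: cascade_output_def[abs_def])
    with p(2) show ?thesis by simp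
  qed
  have "F2vec (m + n) \<noteq> {}" using card_F2vec[of "m + n"] by auto
  then show "Max ((\<lambda>v. least_period (cascade_output m f1 g1 v)) ` F2vec (m + n)) \<le> ?B"
    using bound finite_F2vec by (subst Max_le_iff) auto
qed (rule max_pow2_products)

end
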